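(* Let $A\in\mathbb{R}^{d\times d}$ be an invertible matrix, let $a(x)=Ax$, let $\psi:\mathbb{R}^d\to[0,\infty)$ be a nonnegative bounded function supported in the unit ball of $\mathbb{R}^d$, and let $K(x,y)=\psi(y-a(x))+\psi(x-a(y))$. Then, for $1\le p<\infty$, $$\lambda_{1,p}(\mathbb{R}^d)=2\left|\frac{1}{|\det A|^{1/p}}-1\right|^p\left(\int_{\mathbb{R}^d}\psi(x)\,dx\right).$$
   Context: For a nonnegative symmetric kernel $K$ on $\mathbb{R}^d\times\mathbb{R}^d$ and $1\le p<\infty$, the first eigenvalue is defined by $$\lambda_{1,p}(\mathbb{R}^d)=\inf_{u\in L^p(\mathbb{R}^d),\,u\ne 0}\frac{\int_{\mathbb{R}^d}\int_{\mathbb{R}^d}K(x,y)|u(x)-u(y)|^p\,dx\,dy}{\int_{\mathbb{R}^d}|u|^p(x)\,dx}$$ (the infimum is not claimed to be attained). All functions are Lebesgue measurable. *)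

theory Defs
  imports "HOL-Analysis.Analysis"
begin

definition Lp_function :: "real \<Rightarrow> ('a::euclidean_space \<Rightarrow> real) \<Rightarrow> bool" where
  "Lp_function p u \<longleftrightarrow>
     u \<in> borel_measurable lebesgue \<and> integrable lebesgue (\<lambda>x. \<bar>u x\<bar> powr p)"

text \<open>Elements of \<open>L\<^sup>p\<close> are classes modulo null sets, so \<open>u \<noteq> 0\<close> means that \<open>u\<close> does not vanish
  almost everywhere. For a general kernel the numerator may be infinite; the quotients and their
  infimum are therefore taken in \<^typ>\<open>ennreal\<close>. The denominator is always positive and finite.\<close>

definition first_eigenvalue :: "real \<Rightarrow> ('a::euclidean_space \<Rightarrow> 'a \<Rightarrow> real) \<Rightarrow> ennreal" where
  "first_eigenvalue p K =
     (INF u \<in> {u. Lp_function p u \<and> \<not> (AE x in lebesgue. u x = 0)}.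
        (\<integral>\<^sup>+ y. (\<integral>\<^sup>+ x. ennreal (K x y * \<bar>u x - u y\<bar> powr p) \<partial>lebesgue) \<partial>lebesgue)
        / (\<integral>\<^sup>+ x. ennreal (\<bar>u x\<bar> powr p) \<partial>lebesgue))"

end

theory Submission
  imports Defs "HOL-Real_Asymp.Real_Asymp"
begin

text \<open>
  The substitution \<open>y = A x + z\<close> turns the numerator of the quotient into
  \<open>2 \<integral> \<psi> z \<parallel>u - u (A \<cdot> + z)\<parallel>\<^sup>p dz\<close>, where \<open>\<parallel>u (A \<cdot> + z)\<parallel> = D \<parallel>u\<parallel>\<close> in \<open>L\<^sup>p\<close> with
  \<open>D = \<bar>det A\<bar> powr (- 1 / p)\<close>. The reverse triangle inequality in \<open>L\<^sup>p\<close> gives the lower bound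
  \<open>\<bar>D - 1\<bar> \<parallel>u\<parallel>\<close> for the norm of the difference. For the upper bound one needs densities \<open>f\<close> that
  are almost invariant in \<open>L\<^sup>1\<close> under \<open>f \<mapsto> \<bar>det A\<bar> f (A \<cdot> + z)\<close>, uniformly in \<open>\<parallel>z\<parallel> \<le> 1\<close>: the averages of
  \<open>\<bar>det A\<bar> ^ k g (A ^ k \<cdot>)\<close> over \<open>k < N\<close> with \<open>g x = exp (- c \<parallel>x\<parallel>)\<close> have this property, since they telescope
  for \<open>z = 0\<close>, and \<open>g\<close> changes only by a factor close to 1 under bounded translations if \<open>c\<close> is small.
  Then \<open>u = f powr (1 / p)\<close> is almost optimal.
\<close>

section \<open>Pointwise inequalities for p-th powers\<close>

text \<open>Convexity of \<open>r powr p\<close>, applied to \<open>s + t\<close> as the combination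
  of \<open>s / (1 - \<theta>)\<close> and \<open>t / \<theta>\<close> with weights
  \<open>1 - \<theta>\<close> and \<open>\<theta>\<close>. The weight stays free: the lower bound
  takes it as a ratio of norms, the upper bound lets it tend to 0, where the factor of
  \<open>s powr p\<close> tends to 1.\<close>

lemma powr_add_le_weighted:
  fixes s t \<theta> p :: real
  assumes "0 \<le> s" "0 \<le> t" "0 < \<theta>" "\<theta> < 1" "1 \<le> p"
  shows "(s + t) powr p \<le> (1 - \<theta>) powr (1 - p) * s powr p + \<theta> powr (1 - p) * t powr p"
proof -
  \<comment> \<open>Both coefficients are at least 1, since \<open>1 - p \<le> 0\<close>. This
    settles the cases with a zero summand and leaves positive arguments for convexity.\<close>
  have ge1: "r powr p \<le> c powr (1 - p) * r powr p" if "0 < c" "c < 1" for c r :: real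
  proof -
    have "1 powr (1 - p) \<le> c powr (1 - p)"
      using that assms(5) by (intro powr_mono2') auto
    then show ?thesis
      using mult_right_mono[of 1 "c powr (1 - p)" "r powr p"] by simp
  qed
  have scale: "c * (r / c) powr p = c powr (1 - p) * r powr p" if "0 < c" "0 < r" for c r :: real
    using that by (simp add: powr_divide powr_diff)
  consider "s = 0" | "t = 0" | "0 < s" "0 < t"
    using assms by linarith
  then show ?thesis
  proof cases
    case 1 then show ?thesis using ge1[of \<theta> t] assms by simp
  next
    case 2 then show ?thesis using ge1[of "1 - \<theta>" s] assms by simp
  next
    case 3
    have "((1 - \<theta>) *\<^sub>R (s / (1 - \<theta>)) + \<theta> *\<^sub>R (t / \<theta>)) powr p
        \<le> (1 - \<theta>) * (s / (1 - \<theta>)) powr p + \<theta> * (t / \<theta>) powr p"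
      using 3 assms by (intro convex_onD[OF powr_convex]) auto
    then show ?thesis
      using 3 assms by (simp add: scale)
  qed
qed

lemma abs_add_powr_le_weighted:
  fixes s t \<theta> p :: real
  assumes "0 < \<theta>" "\<theta> < 1" "1 \<le> p"
  shows "\<bar>s + t\<bar> powr p \<le> (1 - \<theta>) powr (1 - p) * \<bar>s\<bar> powr p + \<theta> powr (1 - p) * \<bar>t\<bar> powr p"
proof -
  have "\<bar>s + t\<bar> powr p \<le> (\<bar>s\<bar> + \<bar>t\<bar>) powr p"
    using assms by (intro powr_mono2) auto
  also note powr_add_le_weighted[of "\<bar>s\<bar>" "\<bar>t\<bar>" \<theta> p]
  finally show ?thesis using assms by simp
qed

text \<open>After writing \<open>r powr p\<close> as \<open>r * r powr (p - 1)\<close>, the second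
  factor can only grow when \<open>s\<close> or \<open>t\<close> is replaced there by
  \<open>s + t\<close>.\<close>

lemma powr_add_superadditive:
  fixes s t p :: real
  assumes "0 \<le> s" "0 \<le> t" "1 \<le> p"
  shows "s powr p + t powr p \<le> (s + t) powr p"
proof -
  have split: "r powr p = r * r powr (p - 1)" if "0 \<le> r" for r :: real
    using that by (cases "r = 0") (simp_all add: powr_diff)
  have "s * s powr (p - 1) + t * t powr (p - 1)
      \<le> s * (s + t) powr (p - 1) + t * (s + t) powr (p - 1)"
    using assms by (intro add_mono mult_left_mono powr_mono2) auto
  then show ?thesis
    using assms by (simp add: split algebra_simps)
qed

text \<open>Superadditivity, with the larger number split into the smaller one and the difference.
  It turns L^1 closeness of densities into L^p closeness of their p-th roots.\<close>

lemma abs_diff_powr_le: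
  fixes s t p :: real
  assumes "0 \<le> s" "0 \<le> t" "1 \<le> p"
  shows "\<bar>s - t\<bar> powr p \<le> \<bar>s powr p - t powr p\<bar>"
  using powr_add_superadditive[of "s - t" t p] powr_add_superadditive[of "t - s" s p] assms
  by (cases "s \<le> t") (auto simp: abs_if)


section \<open>Linear changes of variables for Lebesgue measure\<close>

lemma nn_integral_lborel_translate:
  fixes f :: "'a::euclidean_space \<Rightarrow> ennreal"
  assumes "f \<in> borel_measurable borel"
  shows "(\<integral>\<^sup>+ x. f (x + z) \<partial>lborel) = (\<integral>\<^sup>+ x. f x \<partial>lborel)"
proof -
  have "(\<integral>\<^sup>+ x. f x \<partial>lborel) = (\<integral>\<^sup>+ x. f x \<partial>(distr lborel borel ((+) z)))"
    by (simp add: lborel_distr_plus)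
  then show ?thesis
    using assms by (simp add: nn_integral_distr add.commute)
qed

text \<open>By Fubini the coordinate along \<open>b\<close> can be integrated first. With the others
  fixed, the shear translates it by \<open>c * x b'\<close>, which is constant in that integral
  because \<open>b' \<noteq> b\<close>.\<close>

lemma nn_integral_lborel_shear:
  fixes f :: "'a::euclidean_space \<Rightarrow> ennreal"
  assumes f[measurable]: "f \<in> borel_measurable borel" and b: "b \<in> Basis" "b' \<in> Basis" "b \<noteq> b'"
  shows "(\<integral>\<^sup>+ x. f (x + (c * (x \<bullet> b')) *\<^sub>R b) \<partial>lborel) = (\<integral>\<^sup>+ x. f x \<partial>lborel)"
proof -
  interpret product_sigma_finite "\<lambda>_::'a. lborel :: real measure"
    by standard
  define J where "J = (Basis :: 'a set) - {b}"
  have J: "finite J" "b \<notin> J" "b' \<in> J" "Basis = insert b J"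
    using b by (auto simp: J_def)
  have upd: "(\<Sum>j\<in>Basis. (x(b := y)) j *\<^sub>R j) = (\<Sum>j\<in>J. x j *\<^sub>R j) + y *\<^sub>R b" for x y
  proof -
    have "(\<Sum>j\<in>J. (x(b := y)) j *\<^sub>R j) = (\<Sum>j\<in>J. x j *\<^sub>R j)"
      using J(2) by (intro sum.cong) auto
    then show ?thesis
      using J(1,2) by (simp add: J(4) add.commute)
  qed
  have expand: "(\<integral>\<^sup>+ x. F x \<partial>lborel)
      = (\<integral>\<^sup>+ x. \<integral>\<^sup>+ y. F ((\<Sum>j\<in>J. x j *\<^sub>R j) + y *\<^sub>R b) \<partial>lborel \<partial>Pi\<^sub>M J (\<lambda>_. lborel))"
    if [measurable]: "F \<in> borel_measurable borel" for F :: "'a \<Rightarrow> ennreal"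
  proof -
    have "(\<integral>\<^sup>+ x. F x \<partial>lborel)
        = (\<integral>\<^sup>+ x. F (\<Sum>j\<in>Basis. x j *\<^sub>R j) \<partial>Pi\<^sub>M (insert b J) (\<lambda>_. lborel))"
      by (subst lborel_eq) (simp add: nn_integral_distr J(4))
    also have "\<dots> = (\<integral>\<^sup>+ x. \<integral>\<^sup>+ y. F (\<Sum>j\<in>Basis. (x(b := y)) j *\<^sub>R j) \<partial>lborel \<partial>Pi\<^sub>M J (\<lambda>_. lborel))"
      using J by (subst product_nn_integral_insert) (simp_all add: J(4))
    finally show ?thesis
      by (simp only: upd)
  qed
  have inner: "((\<Sum>j\<in>J. x j *\<^sub>R j) + y *\<^sub>R b) \<bullet> b' = x b'" for x y
  proof -
    have "(\<Sum>j\<in>J. x j *\<^sub>R j) \<bullet> b' = (\<Sum>j\<in>J. if j = b' then x j else 0)"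
      unfolding inner_sum_left using b by (intro sum.cong) (auto simp: J_def inner_Basis)
    then show ?thesis
      using b J by (simp add: inner_add_left inner_Basis)
  qed
  have "(\<integral>\<^sup>+ x. f (x + (c * (x \<bullet> b')) *\<^sub>R b) \<partial>lborel)
      = (\<integral>\<^sup>+ x. \<integral>\<^sup>+ y. f ((\<Sum>j\<in>J. x j *\<^sub>R j) + (y + c * x b') *\<^sub>R b) \<partial>lborel \<partial>Pi\<^sub>M J (\<lambda>_. lborel))"
    by (subst expand) (simp_all add: inner scaleR_add_left add.assoc)
  also have "\<dots> = (\<integral>\<^sup>+ x. \<integral>\<^sup>+ y. f ((\<Sum>j\<in>J. x j *\<^sub>R j) + y *\<^sub>R b) \<partial>lborel \<partial>Pi\<^sub>M J (\<lambda>_. lborel))"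
  proof (rule nn_integral_cong)
    fix x :: "'a \<Rightarrow> real"
    show "(\<integral>\<^sup>+ y. f ((\<Sum>j\<in>J. x j *\<^sub>R j) + (y + c * x b') *\<^sub>R b) \<partial>lborel)
        = (\<integral>\<^sup>+ y. f ((\<Sum>j\<in>J. x j *\<^sub>R j) + y *\<^sub>R b) \<partial>lborel)"
      by (rule nn_integral_lborel_translate[of "\<lambda>y. f ((\<Sum>j\<in>J. x j *\<^sub>R j) + y *\<^sub>R b)"]) measurable
  qed
  also have "\<dots> = (\<integral>\<^sup>+ x. f x \<partial>lborel)"
    by (rule expand[symmetric]) measurable
  finally show ?thesis .
qed

lemma prod_Basis_cart:
  fixes x :: "real ^ 'n"
  shows "(\<Prod>b\<in>Basis. x \<bullet> b) = (\<Prod>i\<in>UNIV. x $ i)"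
proof -
  have B: "(Basis :: (real ^ 'n) set) = (\<lambda>i. axis i 1) ` UNIV"
    by (auto simp: Basis_vec_def)
  have inj: "inj (\<lambda>i::'n. axis i (1::real))"
    by (auto simp: inj_def axis_eq_axis)
  show ?thesis
    by (simp add: B prod.reindex[OF inj] inner_axis)
qed

text \<open>Lebesgue measure is determined by its values on boxes, and the preimage of a box is the
  box with permuted side lengths.\<close>

lemma lborel_distr_permute:
  assumes p: "p permutes (UNIV :: 'n::finite set)"
  shows "distr lborel borel (\<lambda>x. \<chi> i. x $ p i) = (lborel :: (real ^ 'n) measure)" (is "distr _ _ ?T = _")
proof (rule lborel_eqI[symmetric])
  fix l u :: "real ^ 'n" assume "\<And>b. b \<in> Basis \<Longrightarrow> l \<bullet> b \<le> u \<bullet> b"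
  then have lu: "l $ i \<le> u $ i" for i
    by (metis axis_in_Basis_iff inner_axis inner_real_def mult.right_neutral Basis_real_def singletonI)
  define q where "q = inv p"
  have [simp]: "p (q i) = i" "q (p i) = i" for i
    using permutes_inverses[OF p] by (auto simp: q_def)
  have "(\<forall>i. l $ i < x $ p i \<and> x $ p i < u $ i) \<longleftrightarrow> (\<forall>i. l $ q i < x $ i \<and> x $ i < u $ q i)" for x
    by (metis \<open>\<And>i. p (q i) = i\<close> \<open>\<And>i. q (p i) = i\<close>)
  then have vimage: "?T -` box l u = box (\<chi> i. l $ q i) (\<chi> i. u $ q i)"
    by (auto simp: mem_box_cart set_eq_iff)
  have T: "?T \<in> borel_measurable borel"
    by (intro borel_measurable_continuous_onI continuous_intros)
  have "emeasure (distr lborel borel ?T) (box l u) = emeasure lborel (box (\<chi> i. l $ q i) (\<chi> i. u $ q i))"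
    using T by (simp add: emeasure_distr vimage)
  also have "\<dots> = ennreal (\<Prod>i\<in>UNIV. (u - l) $ q i)"
  proof (subst emeasure_lborel_box)
    show "(\<chi> i. l $ q i) \<bullet> b \<le> (\<chi> i. u $ q i) \<bullet> b" if "b \<in> Basis" for b
      using that lu by (auto simp: Basis_vec_def inner_axis)
  qed (simp add: prod_Basis_cart)
  also have "(\<Prod>i\<in>UNIV. (u - l) $ q i) = (\<Prod>i\<in>UNIV. (u - l) $ i)"
    using prod.permute[OF permutes_inv[OF p], of "\<lambda>i. (u - l) $ i"] by (simp add: q_def o_def)
  finally show "emeasure (distr lborel borel ?T) (box l u) = (\<Prod>b\<in>Basis. (u - l) \<bullet> b)"
    by (simp only: prod_Basis_cart)
qed simp

lemma nn_integral_lborel_diagonal: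
  fixes f :: "real ^ 'n \<Rightarrow> ennreal"
  assumes f: "f \<in> borel_measurable borel" and d: "\<And>i. d i \<noteq> 0"
  shows "(\<integral>\<^sup>+ x. f x \<partial>lborel) = ennreal \<bar>\<Prod>i\<in>UNIV. d i\<bar> * (\<integral>\<^sup>+ x. f (\<chi> i. d i * x $ i) \<partial>lborel)"
proof -
  define c where "c = (\<lambda>b::real ^ 'n. (\<chi> i. d i) \<bullet> b)"
  \<comment> \<open>The summand 0 is the offset in \<open>lborel_affine_euclidean\<close>; it is
    kept so that the map matches that result literally.\<close>
  let ?T = "\<lambda>x::real ^ 'n. 0 + (\<Sum>j\<in>Basis. (c j * (x \<bullet> j)) *\<^sub>R j)"
  have T: "?T x = (\<chi> i. d i * x $ i)" for x
    by (rule euclidean_eqI)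
      (auto simp: c_def inner_sum_left inner_Basis Basis_vec_def inner_axis if_distrib
        cong: if_cong)
  have c0: "c j \<noteq> 0" if "j \<in> Basis" for j
    using that d by (auto simp: c_def Basis_vec_def inner_axis)
  have "(\<Prod>j\<in>Basis. \<bar>c j\<bar>) = \<bar>\<Prod>j\<in>Basis. c j\<bar>"
    by (simp add: abs_prod)
  also have "\<dots> = \<bar>\<Prod>i\<in>UNIV. d i\<bar>"
    by (simp add: c_def prod_Basis_cart)
  finally have prod: "(\<Prod>j\<in>Basis. \<bar>c j\<bar>) = \<bar>\<Prod>i\<in>UNIV. d i\<bar>" .
  have "?T \<in> borel_measurable borel" by simp
  moreover have "(\<integral>\<^sup>+ x. f x \<partial>lborel)
      = (\<integral>\<^sup>+ x. f x \<partial>density (distr lborel borel ?T) (\<lambda>_. \<Prod>j\<in>Basis. \<bar>c j\<bar>))"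
    using lborel_affine_euclidean[of c 0] c0 by simp
  ultimately show ?thesis
    using f by (simp add: nn_integral_density nn_integral_distr nn_integral_cmult T prod
        del: add_0_left)
qed

text \<open>The change of variables theorems of the library require a wellordered index type.\<close>

lemma nn_integral_lborel_matrix:
  fixes A :: "real ^ 'n ^ 'n"
  assumes "det A \<noteq> 0" "f \<in> borel_measurable borel"
  shows "(\<integral>\<^sup>+ x. f x \<partial>lborel) = ennreal \<bar>det A\<bar> * (\<integral>\<^sup>+ x. f (A *v x) \<partial>lborel)"
  using assms
\<comment> \<open>Every matrix is built from elementary ones. Determinants multiply along products,
  a zero row contradicts \<open>det A \<noteq> 0\<close>, a diagonal matrix scales the axes, a swap
  permutes coordinates with determinant of absolute value 1, and adding a multiple of one coordinate
  to another is a shear of determinant 1.\<close>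
proof (induction A arbitrary: f rule: induct_matrix_elementary
    [case_names mult zero_row diagonal swap idplus])
  case (mult A B)
  have "(*v) A \<in> borel_measurable borel"
    by (intro borel_measurable_continuous_onI linear_continuous_on matrix_vector_mul_bounded_linear)
  then have "(\<lambda>x. f (A *v x)) \<in> borel_measurable borel"
    using mult.prems(2) by simp
  then show ?case
    using mult.IH(1)[of f] mult.IH(2)[of "\<lambda>x. f (A *v x)"] mult.prems
    by (simp add: det_mul abs_mult ennreal_mult mult.assoc matrix_vector_mul_assoc)
next
  case (zero_row A i)
  then show ?case by (simp add: det_zero_row)
next
  case (diagonal A)
  have det: "det A = (\<Prod>i\<in>UNIV. A $ i $ i)"
    using diagonal(1) by (rule det_diagonal)
  have "A *v x = (\<chi> i. A $ i $ i * x $ i)" for x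
  proof -
    have "(\<Sum>j\<in>UNIV. A $ i $ j * x $ j) = (\<Sum>j\<in>UNIV. if j = i then A $ i $ i * x $ i else 0)" for i
      using diagonal(1) by (intro sum.cong) auto
    then show ?thesis by (simp add: matrix_vector_mult_def)
  qed
  then show ?case
    using nn_integral_lborel_diagonal[of f "\<lambda>i. A $ i $ i"] diagonal(2,3) by (simp add: det)
next
  case (swap m n)
  let ?\<tau> = "Transposition.transpose m n"
  let ?S = "(\<chi> i j. mat 1 $ i $ ?\<tau> j) :: real ^ 'n ^ 'n"
  have \<tau>: "?\<tau> permutes UNIV" by (simp add: permutes_swap_id)
  have det: "\<bar>det ?S\<bar> = 1"
    using det_permute_columns[OF \<tau>, of "mat 1 :: real ^ 'n ^ 'n"] by (simp add: sign_def)
  have "(\<Sum>j\<in>UNIV. mat 1 $ i $ ?\<tau> j * x $ j) = (\<Sum>j\<in>UNIV. if j = ?\<tau> i then x $ j else 0)"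
    for x :: "real ^ 'n" and i
    by (intro sum.cong) (auto simp: mat_def)
  then have S: "?S *v x = (\<chi> i. x $ ?\<tau> i)" for x
    by (simp add: matrix_vector_mult_def)
  have T: "(\<lambda>x. \<chi> i. x $ ?\<tau> i) \<in> borel_measurable (borel :: (real ^ 'n) measure)"
    by (intro borel_measurable_continuous_onI continuous_intros)
  have "(\<integral>\<^sup>+ x. f x \<partial>lborel) = (\<integral>\<^sup>+ x. f x \<partial>distr lborel borel (\<lambda>x. \<chi> i. x $ ?\<tau> i))"
    by (simp add: lborel_distr_permute[OF \<tau>])
  then show ?case
    using swap.prems(2) T by (simp only: det S) (simp add: nn_integral_distr)
next
  case (idplus m n c)
  let ?E = "(\<chi> i j. if i = m \<and> j = n then c else of_bool (i = j)) :: real ^ 'n ^ 'n"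
  have "?E = (\<chi> k. if k = m then row m (mat 1) + c *s row n (mat 1) else row k (mat 1))"
    using idplus(1) by (auto simp: vec_eq_iff row_def mat_def)
  then have det: "det ?E = 1"
    using det_row_operation[OF idplus(1), of "mat 1 :: real ^ 'n ^ 'n" c] by simp
  have "(\<Sum>j\<in>UNIV. ?E $ i $ j * x $ j)
      = (\<Sum>j\<in>UNIV. (if j = i then x $ i else 0) + (if j = n then if i = m then c * x $ n else 0 else 0))"
    for x i
    using idplus(1) by (intro sum.cong) auto
  then have "?E *v x = x + (c * x $ n) *\<^sub>R axis m 1" for x
    by (simp add: matrix_vector_mult_def vec_eq_iff sum.distrib axis_def)
  then have "?E *v x = x + (c * (x \<bullet> axis n 1)) *\<^sub>R axis m 1" for x
    by (simp add: inner_axis)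
  then show ?case
    using nn_integral_lborel_shear[of f "axis m 1" "axis n 1" c] idplus
    by (simp only: det) (simp add: axis_in_Basis_iff axis_eq_axis)
qed

lemma nn_integral_lborel_affine_matrix:
  fixes A :: "real ^ 'n ^ 'n" and f :: "real ^ 'n \<Rightarrow> ennreal"
  assumes A: "invertible A" and f: "f \<in> borel_measurable borel"
  shows "(\<integral>\<^sup>+ x. f (A *v x + z) \<partial>lborel) = ennreal (1 / \<bar>det A\<bar>) * (\<integral>\<^sup>+ x. f x \<partial>lborel)"
proof -
  have detA: "det A \<noteq> 0"
    using A invertible_det_nz by blast
  have "(\<integral>\<^sup>+ x. f x \<partial>lborel) = (\<integral>\<^sup>+ x. f (x + z) \<partial>lborel)"
    using f by (simp add: nn_integral_lborel_translate)
  also have "\<dots> = ennreal \<bar>det A\<bar> * (\<integral>\<^sup>+ x. f (A *v x + z) \<partial>lborel)"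
    using detA f by (subst nn_integral_lborel_matrix[of A]) auto
  finally show ?thesis
    using detA by (simp flip: ennreal_mult mult.assoc)
qed

section \<open>Integrability of the exponential profile\<close>

text \<open>Where the norm lies between \<open>n\<close> and \<open>n + 1\<close>, the integrand is
  at most \<open>exp (- c * n)\<close>, and the ball of radius \<open>n + 1\<close> has volume
  polynomial in \<open>n\<close>; the resulting series converges.\<close>

lemma nn_integral_exp_norm_finite:
  fixes c :: real
  assumes "0 < c"
  shows "(\<integral>\<^sup>+ x. ennreal (exp (- c * norm x)) \<partial>(lborel :: 'a::euclidean_space measure)) < \<infinity>"
proof -
  define V where "V = measure lborel (cball (0::'a) 1)"
  define D where "D = DIM('a)"
  have vol: "emeasure lborel (cball (0::'a) r) = ennreal (V * r ^ D)" if "0 \<le> r" for r :: real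
    unfolding V_def D_def
    using that by (simp add: emeasure_cball content_cball)
  have sm: "summable (\<lambda>n. exp (- c * real n) * (V * (1 + real n) ^ D))"
  proof (rule summable_comparison_test_bigo)
    \<comment> \<open>Half of the decay rate is spent on absorbing the polynomial factor; the other
      half leaves a geometric series.\<close>
    show "summable (\<lambda>n. norm (exp (- c / 2) ^ n))"
      using assms by (simp add: norm_power summable_geometric)
    have "(\<lambda>n. exp (- c * real n) * (1 + real n) ^ D) \<in> O(\<lambda>n. exp (- c / 2 * real n))"
      using assms by real_asymp
    then have "(\<lambda>n. V * (exp (- c * real n) * (1 + real n) ^ D)) \<in> O(\<lambda>n. exp (- c / 2 * real n))"
      by (cases "V = 0") simp_all
    then show "(\<lambda>n. exp (- c * real n) * (V * (1 + real n) ^ D)) \<in> O(\<lambda>n. exp (- c / 2) ^ n)"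
      by (simp add: exp_of_nat2_mult[symmetric] mult_ac)
  qed
  have "ennreal (exp (- c * norm x))
      \<le> (\<Sum>n. ennreal (exp (- c * real n)) * indicator (cball 0 (1 + real n)) x)" for x :: 'a
  proof -
    \<comment> \<open>The point lies in the ball of radius \<open>?n + 1\<close>, so this single
      term of the series already dominates.\<close>
    let ?n = "nat \<lfloor>norm x\<rfloor>"
    have n: "real ?n \<le> norm x" "norm x \<le> 1 + real ?n"
      using of_nat_floor[of "norm x"] by (simp_all, linarith)
    have "ennreal (exp (- c * norm x))
        \<le> ennreal (exp (- c * real ?n)) * indicator (cball 0 (1 + real ?n)) x"
      using n assms by (simp add: ennreal_leI)
    also have "\<dots> \<le> (\<Sum>n. ennreal (exp (- c * real n)) * indicator (cball 0 (1 + real n)) x)"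
      using sum_le_suminf[OF summableI, of "{?n}"
          "\<lambda>n. ennreal (exp (- c * real n)) * indicator (cball 0 (1 + real n)) x"]
      by simp
    finally show ?thesis .
  qed
  then have "(\<integral>\<^sup>+ x. ennreal (exp (- c * norm (x::'a))) \<partial>lborel)
      \<le> (\<integral>\<^sup>+ x. (\<Sum>n. ennreal (exp (- c * real n)) * indicator (cball 0 (1 + real n)) (x::'a)) \<partial>lborel)"
    by (intro nn_integral_mono)
  also have "\<dots> = (\<Sum>n. ennreal (exp (- c * real n)) * emeasure lborel (cball (0::'a) (1 + real n)))"
  proof -
    have [measurable]: "cball (0::'a) (1 + real n) \<in> sets lborel" for n
      by simp
    show ?thesis
      by (subst nn_integral_suminf) (measurable, simp add: nn_integral_cmult_indicator)
  qed
  also have "\<dots> = (\<Sum>n. ennreal (exp (- c * real n) * (V * (1 + real n) ^ D)))"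
    by (intro suminf_cong) (simp add: vol ennreal_mult V_def)
  also have "\<dots> < \<infinity>"
    using sm by (simp add: suminf_ennreal_eq V_def suminf_ennreal2)
  finally show ?thesis .
qed

section \<open>The reverse triangle inequality in L^p\<close>

text \<open>The numbers \<open>\<alpha>\<close> and \<open>\<beta>\<close> are the L^p norms of
  \<open>s\<close> and \<open>t\<close> in the common unit \<open>U powr (1 / p)\<close>. The
  weighted inequality for \<open>s = (s - t) + t\<close> is integrated, with the weight chosen so
  that nothing is lost; an infinite right-hand side is trivial.\<close>

lemma nn_integral_abs_diff_powr_ge_aux:
  fixes s t :: "'a \<Rightarrow> real" and \<alpha> \<beta> U p :: real
  assumes [measurable]: "s \<in> borel_measurable M" "t \<in> borel_measurable M"
    and s: "(\<integral>\<^sup>+ x. ennreal (\<bar>s x\<bar> powr p) \<partial>M) = ennreal (\<alpha> powr p * U)"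
    and t: "(\<integral>\<^sup>+ x. ennreal (\<bar>t x\<bar> powr p) \<partial>M) = ennreal (\<beta> powr p * U)"
    and "0 < \<beta>" "\<beta> < \<alpha>" "0 \<le> U" "1 \<le> p"
  shows "ennreal ((\<alpha> - \<beta>) powr p * U) \<le> (\<integral>\<^sup>+ x. ennreal (\<bar>s x - t x\<bar> powr p) \<partial>M)" (is "_ \<le> ?X")
proof (cases ?X rule: ennreal_cases)
  case (real r)
  \<comment> \<open>This is the weight for which the inequality is sharp when \<open>t\<close> is
    \<open>\<theta>\<close> times \<open>s\<close>: the term of \<open>t\<close> becomes
    \<open>\<theta> * \<alpha> powr p * U\<close>, and what remains collapses to
    \<open>((1 - \<theta>) * \<alpha>) powr p * U\<close>.\<close>
  define \<theta> where "\<theta> = \<beta> / \<alpha>"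
  have \<theta>: "0 < \<theta>" "\<theta> < 1" using assms by (auto simp: \<theta>_def)
  let ?k = "(1 - \<theta>) powr (1 - p)" and ?l = "\<theta> powr (1 - p)"
  have "(\<integral>\<^sup>+ x. ennreal (\<bar>s x\<bar> powr p) \<partial>M)
      \<le> (\<integral>\<^sup>+ x. ennreal ?k * ennreal (\<bar>s x - t x\<bar> powr p) + ennreal ?l * ennreal (\<bar>t x\<bar> powr p) \<partial>M)"
    using abs_add_powr_le_weighted[OF \<theta> \<open>1 \<le> p\<close>, of "s x - t x" "t x" for x]
    by (intro nn_integral_mono) (simp flip: ennreal_mult ennreal_plus)
  also have "\<dots> = ennreal ?k * ?X + ennreal ?l * ennreal (\<beta> powr p * U)"
    by (simp add: nn_integral_add nn_integral_cmult t)
  finally have "\<alpha> powr p * U \<le> ?k * r + ?l * (\<beta> powr p * U)"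
    using real \<open>0 \<le> U\<close> by (simp add: s flip: ennreal_mult ennreal_plus)
  moreover have "?l * \<beta> powr p = \<theta> * \<alpha> powr p"
    using assms \<theta> by (simp add: \<theta>_def powr_divide powr_diff)
  ultimately have "\<alpha> powr p * U * (1 - \<theta>) \<le> ?k * r"
    by (simp add: algebra_simps)
  then have "(1 - \<theta>) powr (p - 1) * (\<alpha> powr p * U * (1 - \<theta>)) \<le> (1 - \<theta>) powr (p - 1) * (?k * r)"
    by (intro mult_left_mono) auto
  also have "(1 - \<theta>) powr (p - 1) * (?k * r) = r"
    using \<theta> by (simp flip: mult.assoc powr_add)
  also have "(1 - \<theta>) powr (p - 1) * (\<alpha> powr p * U * (1 - \<theta>)) = ((1 - \<theta>) * \<alpha>) powr p * U"
    using \<theta> assms by (simp add: powr_mult powr_diff)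
  also have "(1 - \<theta>) * \<alpha> = \<alpha> - \<beta>"
    using assms by (simp add: \<theta>_def field_simps)
  finally show ?thesis
    using real by (simp add: ennreal_leI)
qed simp

lemma nn_integral_abs_diff_powr_ge:
  fixes s t :: "'a \<Rightarrow> real" and \<alpha> \<beta> U p :: real
  assumes "s \<in> borel_measurable M" "t \<in> borel_measurable M"
    and "(\<integral>\<^sup>+ x. ennreal (\<bar>s x\<bar> powr p) \<partial>M) = ennreal (\<alpha> powr p * U)"
    and "(\<integral>\<^sup>+ x. ennreal (\<bar>t x\<bar> powr p) \<partial>M) = ennreal (\<beta> powr p * U)"
    and "0 < \<alpha>" "0 < \<beta>" "0 \<le> U" "1 \<le> p"
  shows "ennreal (\<bar>\<alpha> - \<beta>\<bar> powr p * U) \<le> (\<integral>\<^sup>+ x. ennreal (\<bar>s x - t x\<bar> powr p) \<partial>M)"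
\<comment> \<open>For equal norms the left-hand side is 0, because
  \<open>0 powr p = 0\<close>.\<close>
proof (cases \<alpha> \<beta> rule: linorder_cases)
  case less
  then show ?thesis
    using nn_integral_abs_diff_powr_ge_aux[of t M s p \<beta> U \<alpha>] assms
    by (simp add: abs_minus_commute)
next
  case greater
  then show ?thesis
    using nn_integral_abs_diff_powr_ge_aux[of s M t p \<alpha> U \<beta>] assms by simp
qed simp

section \<open>Almost invariant densities\<close>

text \<open>The claim is homogeneous in \<open>f\<close>, so the sum over \<open>k < N\<close>
  serves instead of the average. With \<open>G\<close> the mass of each term, the budget
  \<open>\<epsilon> * N * G\<close> is shared equally between the translation errors and the two end
  terms of the telescoping sum.\<close>

lemma almost_invariant_density:
  fixes A :: "real ^ 'n ^ 'n" and \<epsilon> :: real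
  assumes A: "invertible A" and "0 < \<epsilon>"
  obtains f :: "real ^ 'n \<Rightarrow> real" and F :: real
  where "f \<in> borel_measurable borel" "\<And>x. 0 \<le> f x" "0 < F"
    "(\<integral>\<^sup>+ x. ennreal (f x) \<partial>lborel) = ennreal F"
    "\<And>z. norm z \<le> 1 \<Longrightarrow>
      (\<integral>\<^sup>+ x. ennreal \<bar>\<bar>det A\<bar> * f (A *v x + z) - f x\<bar> \<partial>lborel) \<le> ennreal (\<epsilon> * F)"
proof -
  define \<Delta> where "\<Delta> = \<bar>det A\<bar>"
  have "det A \<noteq> 0"
    using A invertible_det_nz by blast
  then have \<Delta>: "0 < \<Delta>" by (simp add: \<Delta>_def)
  \<comment> \<open>The end terms have total mass \<open>2 * G\<close>, which must fit into
    \<open>\<epsilon> / 2 * N * G\<close>.\<close>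
  obtain N :: nat where "4 / \<epsilon> < real N"
    using reals_Archimedean2 by blast
  then have "0 < real N"
    using \<open>0 < \<epsilon>\<close> by (meson divide_pos_pos less_trans zero_less_numeral)
  have N: "2 \<le> \<epsilon> / 2 * real N"
    using \<open>4 / \<epsilon> < real N\<close> \<open>0 < \<epsilon>\<close> by (simp add: field_simps)
  obtain B0 where B0: "\<And>x. norm (A *v x) \<le> B0 * norm x"
    using linear_bounded[of "(*v) A"] by auto
  \<comment> \<open>Having \<open>1 \<le> B\<close> makes \<open>B ^ N\<close> a common bound for
    the operator norms of all powers of \<open>A\<close> below \<open>N\<close>.\<close>
  define B where "B = max 1 B0"
  have B: "1 \<le> B" "norm (A *v x) \<le> B * norm x" for x
    using B0[of x] mult_right_mono[of B0 B "norm x"] by (auto simp: B_def)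
  \<comment> \<open>A unit vector is moved by these powers to norm at most \<open>B ^ N\<close>;
    with this \<open>c\<close>, a translation of that size changes \<open>g\<close> by at most the
    factor \<open>1 + \<epsilon> / 2\<close> in either direction.\<close>
  define c where "c = ln (1 + \<epsilon> / 2) / B ^ N"
  have c: "0 < c" and exp_c: "exp (c * B ^ N) = 1 + \<epsilon> / 2"
    using \<open>0 < \<epsilon>\<close> B(1) by (simp_all add: c_def)
  define g where "g = (\<lambda>x::real ^ 'n. exp (- c * norm x))"
  have g_shift: "\<bar>g (v + w) - g v\<bar> \<le> \<epsilon> / 2 * g v" if "norm w \<le> B ^ N" for v w
  proof -
    let ?E = "exp (c * B ^ N)"
    have cw: "c * norm w \<le> c * B ^ N"
      using that c by simp
    have "c * norm v \<le> c * norm (v + w) + c * norm w" "c * norm (v + w) \<le> c * norm v + c * norm w"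
      using norm_triangle_ineq4[of "v + w" w] norm_triangle_ineq[of v w] c
      by (simp_all flip: distrib_left)
    then have "- c * norm (v + w) \<le> c * B ^ N - c * norm v"
       "- (c * B ^ N) - c * norm v \<le> - c * norm (v + w)"
      using cw by linarith+
    then have "g (v + w) \<le> ?E * g v" "exp (- (c * B ^ N)) * g v \<le> g (v + w)"
      by (simp_all add: g_def flip: exp_add)
    \<comment> \<open>With \<open>?E\<close> the exponential factor,
      \<open>2 - ?E \<le> 1 / ?E\<close> says that the hyperbolic cosine is at least 1.\<close>
    moreover have "(2 - ?E) * g v \<le> exp (- (c * B ^ N)) * g v"
      using exp_ge_add_one_self[of "c * B ^ N"] exp_ge_add_one_self[of "- (c * B ^ N)"] 
        cosh_real_ge_1[of "c * B ^ N"]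
      by (intro mult_right_mono) (auto simp: g_def cosh_def)
    ultimately have "g (v + w) - g v \<le> \<epsilon> / 2 * g v" "- (g (v + w) - g v) \<le> \<epsilon> / 2 * g v"
      by (simp_all add: exp_c algebra_simps)
    then show ?thesis
      by (rule abs_leI)
  qed
  define L where "L = (\<lambda>k. (*v) A ^^ k)"
  \<comment> \<open>The innermost factor is peeled off, so that substituting \<open>A *v x\<close>
    and multiplying by \<open>\<Delta>\<close> turns \<open>h k\<close> into
    \<open>h (Suc k)\<close>.\<close>
  have L_Suc: "L (Suc k) x = L k (A *v x)" for k x
    by (simp add: L_def funpow_swap1)
  have L_add: "L k (x + y) = L k x + L k y" for k x y
    by (induction k) (simp_all add: L_def matrix_vector_right_distrib)
  have L_norm: "norm (L k x) \<le> B ^ k * norm x" for k x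
  proof (induction k)
    case (Suc k)
    have "norm (L (Suc k) x) \<le> B * norm (L k x)"
      using B(2)[of "L k x"] by (simp add: L_def)
    also have "\<dots> \<le> B * (B ^ k * norm x)"
      using Suc B(1) by (intro mult_left_mono) auto
    finally show ?case by (simp add: mult.assoc)
  qed (simp add: L_def)
  have [measurable]: "(*v) A \<in> borel_measurable borel"
    by (intro borel_measurable_continuous_onI linear_continuous_on matrix_vector_mul_bounded_linear)
  have [measurable]: "L k \<in> borel_measurable borel" for k
    by (induction k) (simp_all add: L_def measurable_comp id_def)
  have [measurable]: "g \<in> borel_measurable borel"
    unfolding g_def by measurable
  define h where "h = (\<lambda>k x. \<Delta> ^ k * g (L k x))"
  have h_nonneg: "0 \<le> h k x" for k x
    using \<Delta> by (simp add: h_def g_def)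
  have [measurable]: "h k \<in> borel_measurable borel" for k
    unfolding h_def by measurable
  have h_Suc: "h (Suc k) x = \<Delta> * h k (A *v x)" for k x
    by (simp add: h_def L_Suc)
  define G where "G = enn2real (\<integral>\<^sup>+ x. ennreal (g x) \<partial>lborel)"
  have "(\<integral>\<^sup>+ x. ennreal (g x) \<partial>lborel) < \<infinity>"
    using nn_integral_exp_norm_finite[OF c, where 'a = "real ^ 'n"] by (simp add: g_def)
  then have G: "(\<integral>\<^sup>+ x. ennreal (g x) \<partial>lborel) = ennreal G"
    by (simp add: G_def)
  have "(\<integral>\<^sup>+ x. ennreal (g x) \<partial>lborel) \<noteq> 0"
    by (subst nn_integral_0_iff) (auto simp: g_def)
  then have "0 < G"
    using G by (metis ennreal_eq_0_iff not_le)
  \<comment> \<open>The factor \<open>\<Delta>\<close> gained at each step cancels the Jacobian of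
    the substitution, so all terms have the same mass.\<close>
  have h_int: "(\<integral>\<^sup>+ x. ennreal (h k x) \<partial>lborel) = ennreal G" for k
  proof (induction k)
    case 0
    then show ?case by (simp add: h_def L_def G)
  next
    case (Suc k)
    have "(\<integral>\<^sup>+ x. ennreal (h (Suc k) x) \<partial>lborel)
        = ennreal \<Delta> * (\<integral>\<^sup>+ x. ennreal (h k (A *v x + 0)) \<partial>lborel)"
      using \<Delta> by (simp add: h_Suc ennreal_mult h_nonneg nn_integral_cmult)
    also have "\<dots> = ennreal \<Delta> * (ennreal (1 / \<Delta>) * ennreal G)"
      unfolding \<Delta>_def Suc[symmetric]
      by (subst nn_integral_lborel_affine_matrix[OF A, of "\<lambda>x. ennreal (h k x)"]) auto
    also have "\<dots> = ennreal G"
      using \<Delta> by (simp flip: mult.assoc ennreal_mult)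
    finally show ?case .
  qed
  \<comment> \<open>By linearity the shift by \<open>z\<close> becomes, inside \<open>g\<close>, a
    shift by \<open>L k z\<close>, whose norm is at most \<open>B ^ N\<close>.\<close>
  have h_shift: "\<bar>\<Delta> * h k (A *v x + z) - h (Suc k) x\<bar> \<le> \<epsilon> / 2 * h (Suc k) x"
    if "k < N" "norm z \<le> 1" for k x z
  proof -
    have "norm (L k z) \<le> B ^ k * norm z" by (rule L_norm)
    also have "\<dots> \<le> B ^ N * 1"
      using that B(1) by (intro mult_mono power_increasing) auto
    finally have "\<bar>g (L k (A *v x) + L k z) - g (L k (A *v x))\<bar> \<le> \<epsilon> / 2 * g (L k (A *v x))"
      by (intro g_shift) simp
    then have "\<Delta> ^ Suc k * \<bar>g (L k (A *v x) + L k z) - g (L k (A *v x))\<bar>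
        \<le> \<Delta> ^ Suc k * (\<epsilon> / 2 * g (L k (A *v x)))"
      using \<Delta> by (intro mult_left_mono) auto
    moreover have "\<Delta> * h k (A *v x + z) - h (Suc k) x
        = \<Delta> ^ Suc k * (g (L k (A *v x) + L k z) - g (L k (A *v x)))"
      by (simp add: h_def L_Suc L_add algebra_simps)
    ultimately show ?thesis
      using \<Delta> by (simp add: h_def L_Suc abs_mult mult_ac)
  qed
  define f where "f = (\<lambda>x. \<Sum>k<N. h k x)"
  show thesis
  proof (rule that[of f "real N * G"])
    show "f \<in> borel_measurable borel" unfolding f_def by measurable
    show "0 \<le> f x" for x by (simp add: f_def h_nonneg sum_nonneg)
    show "0 < real N * G" using \<open>0 < G\<close> \<open>0 < real N\<close> by simp
    have "(\<integral>\<^sup>+ x. ennreal (f x) \<partial>lborel) = (\<integral>\<^sup>+ x. (\<Sum>k<N. ennreal (h k x)) \<partial>lborel)"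
      by (simp add: f_def h_nonneg sum_ennreal)
    also have "\<dots> = ennreal (real N * G)"
      using \<open>0 < G\<close> by (simp add: nn_integral_sum h_int ennreal_of_nat_eq_real_of_nat ennreal_mult)
    finally show "(\<integral>\<^sup>+ x. ennreal (f x) \<partial>lborel) = ennreal (real N * G)" .
    fix z :: "real ^ 'n" assume z: "norm z \<le> 1"
    \<comment> \<open>Inserting \<open>h (Suc k) x\<close> separates the effect of \<open>z\<close>
      from the telescoping sum.\<close>
    have bound: "\<bar>\<Delta> * f (A *v x + z) - f x\<bar>
        \<le> (\<Sum>k<N. \<epsilon> / 2 * h (Suc k) x) + (h N x + h 0 x)" for x
    proof -
      have "\<Delta> * f (A *v x + z) - f x
          = (\<Sum>k<N. \<Delta> * h k (A *v x + z) - h (Suc k) x) + (\<Sum>k<N. h (Suc k) x - h k x)"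
        by (simp add: f_def sum_distrib_left sum_subtractf)
      also have "(\<Sum>k<N. h (Suc k) x - h k x) = h N x - h 0 x"
        by (rule sum_lessThan_telescope)
      finally have "\<bar>\<Delta> * f (A *v x + z) - f x\<bar>
          \<le> \<bar>\<Sum>k<N. \<Delta> * h k (A *v x + z) - h (Suc k) x\<bar> + (h N x + h 0 x)"
        using h_nonneg[of N x] h_nonneg[of 0 x] by linarith
      also have "\<bar>\<Sum>k<N. \<Delta> * h k (A *v x + z) - h (Suc k) x\<bar> \<le> (\<Sum>k<N. \<epsilon> / 2 * h (Suc k) x)"
        using z by (intro order_trans[OF sum_abs] sum_mono h_shift) auto
      finally show ?thesis by simp
    qed
    have "(\<integral>\<^sup>+ x. ennreal \<bar>\<Delta> * f (A *v x + z) - f x\<bar> \<partial>lborel)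
        \<le> (\<integral>\<^sup>+ x. (\<Sum>k<N. ennreal (\<epsilon> / 2) * ennreal (h (Suc k) x))
            + (ennreal (h N x) + ennreal (h 0 x)) \<partial>lborel)"
      using bound \<open>0 < \<epsilon>\<close> h_nonneg
      by (intro nn_integral_mono) (simp add: sum_nonneg flip: ennreal_mult ennreal_plus)
    also have "\<dots> = of_nat N * (ennreal (\<epsilon> / 2) * ennreal G) + (ennreal G + ennreal G)"
      by (simp add: nn_integral_add nn_integral_sum nn_integral_cmult h_int)
    also have "\<dots> = ennreal (real N * (\<epsilon> / 2 * G) + (G + G))"
      using \<open>0 < G\<close> \<open>0 < \<epsilon>\<close>
      by (simp add: ennreal_of_nat_eq_real_of_nat flip: ennreal_mult ennreal_plus)
    also have "\<dots> \<le> ennreal (\<epsilon> * (real N * G))"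
    proof (rule ennreal_leI)
      have "2 * G \<le> \<epsilon> / 2 * real N * G"
        using N \<open>0 < G\<close> by (intro mult_right_mono) auto
      moreover have "\<epsilon> * (real N * G) = real N * (\<epsilon> / 2 * G) + \<epsilon> / 2 * real N * G"
        by (simp add: field_simps)
      ultimately show "real N * (\<epsilon> / 2 * G) + (G + G) \<le> \<epsilon> * (real N * G)"
        by linarith
    qed
    finally show "(\<integral>\<^sup>+ x. ennreal \<bar>\<bar>det A\<bar> * f (A *v x + z) - f x\<bar> \<partial>lborel)
        \<le> ennreal (\<epsilon> * (real N * G))"
      by (simp add: \<Delta>_def)
  qed
qed

section \<open>Rewriting the energy and passing to Borel representatives\<close>

text \<open>The substitution rule for the indicator of a null set shows that its preimage is
  null.\<close>

lemma AE_lborel_affine_matrix: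
  fixes A :: "real ^ 'n ^ 'n"
  assumes A: "invertible A" and P: "AE x in lborel. P x"
  shows "AE x in lborel. P (A *v x + z)"
proof -
  obtain N where N: "{x. \<not> P x} \<subseteq> N" "N \<in> null_sets lborel"
    using P by (auto simp: eventually_ae_filter)
  then have [measurable]: "N \<in> sets borel" by auto
  have [measurable]: "(\<lambda>x. A *v x + z) \<in> borel_measurable borel"
    by (intro borel_measurable_continuous_onI continuous_intros linear_continuous_on
        matrix_vector_mul_bounded_linear)
  have "(\<integral>\<^sup>+ x. indicator N (A *v x + z) \<partial>lborel) = 0"
    using N(2) by (subst nn_integral_lborel_affine_matrix[OF A]) auto
  then have "AE x in lborel. (indicator N (A *v x + z) :: ennreal) = 0"
    by (subst (asm) nn_integral_0_iff_AE) auto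
  then show ?thesis
    using N(1) by (auto elim!: eventually_mono simp: indicator_eq_0_iff)
qed

text \<open>Exchanging \<open>x\<close> and \<open>y\<close> maps one half of the kernel to the
  other and preserves the difference of \<open>u\<close>, so both halves contribute equally. Tonelli
  and the translation \<open>y = A *v x + z\<close> bring each half to the form
  \<open>?J\<close>.\<close>

lemma kernel_energy_borel:
  fixes A :: "real ^ 'n ^ 'n" and k u :: "real ^ 'n \<Rightarrow> real"
  assumes [measurable]: "k \<in> borel_measurable borel" "u \<in> borel_measurable borel"
    and k: "\<And>x. 0 \<le> k x"
  shows "(\<integral>\<^sup>+ y. \<integral>\<^sup>+ x. ennreal ((k (y - A *v x) + k (x - A *v y)) * \<bar>u x - u y\<bar> powr p) \<partial>lborel \<partial>lborel)
    = 2 * (\<integral>\<^sup>+ z. ennreal (k z) * (\<integral>\<^sup>+ x. ennreal (\<bar>u x - u (A *v x + z)\<bar> powr p) \<partial>lborel) \<partial>lborel)"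
proof -
  have [measurable]: "(*v) A \<in> borel_measurable borel"
    by (intro borel_measurable_continuous_onI linear_continuous_on matrix_vector_mul_bounded_linear)
  define w where "w = (\<lambda>x y. ennreal (\<bar>u x - u y\<bar> powr p))"
  have w_sym: "w x y = w y x" for x y
    by (simp add: w_def abs_minus_commute)
  let ?J = "\<integral>\<^sup>+ z. ennreal (k z) * (\<integral>\<^sup>+ x. w x (A *v x + z) \<partial>lborel) \<partial>lborel"
  have J: "(\<integral>\<^sup>+ x. \<integral>\<^sup>+ y. ennreal (k (y - A *v x)) * w x y \<partial>lborel \<partial>lborel) = ?J"
  proof -
    have "(\<integral>\<^sup>+ y. ennreal (k (y - A *v x)) * w x y \<partial>lborel)
        = (\<integral>\<^sup>+ z. ennreal (k z) * w x (A *v x + z) \<partial>lborel)" for x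
      using nn_integral_lborel_translate[of "\<lambda>y. ennreal (k (y - A *v x)) * w x y" "A *v x"]
      by (simp add: w_def add.commute)
    then have "(\<integral>\<^sup>+ x. \<integral>\<^sup>+ y. ennreal (k (y - A *v x)) * w x y \<partial>lborel \<partial>lborel)
        = (\<integral>\<^sup>+ x. \<integral>\<^sup>+ z. ennreal (k z) * w x (A *v x + z) \<partial>lborel \<partial>lborel)"
      by simp
    also have "\<dots> = (\<integral>\<^sup>+ z. \<integral>\<^sup>+ x. ennreal (k z) * w x (A *v x + z) \<partial>lborel \<partial>lborel)"
      unfolding w_def by (rule lborel_pair.Fubini'[symmetric]) measurable
    also have "\<dots> = ?J"
      unfolding w_def by (intro nn_integral_cong nn_integral_cmult) measurable
    finally show ?thesis .
  qed
  have "(\<integral>\<^sup>+ y. \<integral>\<^sup>+ x. ennreal ((k (y - A *v x) + k (x - A *v y)) * \<bar>u x - u y\<bar> powr p) \<partial>lborel \<partial>lborel)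
      = (\<integral>\<^sup>+ y. \<integral>\<^sup>+ x. ennreal (k (y - A *v x)) * w x y + ennreal (k (x - A *v y)) * w x y \<partial>lborel \<partial>lborel)"
    by (simp add: w_def k ennreal_mult ennreal_plus distrib_right)
  also have "\<dots> = (\<integral>\<^sup>+ y. \<integral>\<^sup>+ x. ennreal (k (y - A *v x)) * w x y \<partial>lborel \<partial>lborel)
      + (\<integral>\<^sup>+ y. \<integral>\<^sup>+ x. ennreal (k (x - A *v y)) * w x y \<partial>lborel \<partial>lborel)"
    by (simp add: nn_integral_add w_def)
  also have "(\<integral>\<^sup>+ y. \<integral>\<^sup>+ x. ennreal (k (y - A *v x)) * w x y \<partial>lborel \<partial>lborel)
      = (\<integral>\<^sup>+ x. \<integral>\<^sup>+ y. ennreal (k (y - A *v x)) * w x y \<partial>lborel \<partial>lborel)"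
    unfolding w_def by (rule lborel_pair.Fubini') measurable
  also note J
  also have "(\<integral>\<^sup>+ y. \<integral>\<^sup>+ x. ennreal (k (x - A *v y)) * w x y \<partial>lborel \<partial>lborel) = ?J"
    unfolding J[symmetric] by (subst w_sym) (rule refl)
  finally show ?thesis
    by (simp add: w_def mult_2)
qed

text \<open>This allows Borel representatives in the energy. For fixed \<open>y\<close> both
  arguments of \<open>k\<close> are invertible affine functions of \<open>x\<close>, so exceptional
  null sets pull back to null sets; the values of \<open>y\<close> with
  \<open>u y \<noteq> u' y\<close> are negligible in the outer integral.\<close>

lemma kernel_energy_cong_AE:
  fixes A :: "real ^ 'n ^ 'n" and k k' u u' :: "real ^ 'n \<Rightarrow> real"
  assumes A: "invertible A"
    and k: "AE x in lborel. k x = k' x" and u: "AE x in lborel. u x = u' x"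
  shows "(\<integral>\<^sup>+ y. \<integral>\<^sup>+ x. ennreal ((k (y - A *v x) + k (x - A *v y)) * \<bar>u x - u y\<bar> powr p) \<partial>lborel \<partial>lborel)
    = (\<integral>\<^sup>+ y. \<integral>\<^sup>+ x. ennreal ((k' (y - A *v x) + k' (x - A *v y)) * \<bar>u' x - u' y\<bar> powr p) \<partial>lborel \<partial>lborel)"
proof (rule nn_integral_cong_AE)
  obtain B where "A ** B = mat 1" "B ** A = mat 1"
    using A by (auto simp: invertible_def)
  \<comment> \<open>The map sending \<open>x\<close> to \<open>y - A *v x\<close> has linear part
    \<open>- A\<close>.\<close>
  then have neg: "invertible (- A)"
    unfolding invertible_def by (intro exI[of _ "- B"]) (simp add: matrix_matrix_mult_def vec_eq_iff)
  have negA: "(- A) *v x + y = y - A *v x" for x y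
    by (simp add: matrix_vector_mult_def vec_eq_iff sum_negf)
  have k1: "AE x in lborel. k (y - A *v x) = k' (y - A *v x)" for y
    using AE_lborel_affine_matrix[OF neg k, of y] by (simp only: negA)
  have "invertible (mat 1 :: real ^ 'n ^ 'n)"
    unfolding invertible_def by (intro exI[of _ "mat 1"]) simp
  then have k2: "AE x in lborel. k (x - A *v y) = k' (x - A *v y)" for y
    using AE_lborel_affine_matrix[OF _ k, of "mat 1" "- (A *v y)"] by simp
  have "AE x in lborel. ennreal ((k (y - A *v x) + k (x - A *v y)) * \<bar>u x - u y\<bar> powr p)
      = ennreal ((k' (y - A *v x) + k' (x - A *v y)) * \<bar>u' x - u' y\<bar> powr p)" if "u y = u' y" for y
    using k1[of y] k2[of y] u by eventually_elim (simp add: that)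
  then show "AE y in lborel.
      (\<integral>\<^sup>+ x. ennreal ((k (y - A *v x) + k (x - A *v y)) * \<bar>u x - u y\<bar> powr p) \<partial>lborel)
    = (\<integral>\<^sup>+ x. ennreal ((k' (y - A *v x) + k' (x - A *v y)) * \<bar>u' x - u' y\<bar> powr p) \<partial>lborel)"
    using u by (auto elim!: eventually_mono intro!: nn_integral_cong_AE)
qed

section \<open>The eigenvalue formula\<close>

theorem theorem1p1:
  fixes A :: "real ^ 'd ^ 'd"
    and a :: "real ^ 'd \<Rightarrow> real ^ 'd"
    and \<psi> :: "real ^ 'd \<Rightarrow> real"
    and K :: "real ^ 'd \<Rightarrow> real ^ 'd \<Rightarrow> real"
    and p :: real
  assumes "invertible A"
    and "\<And>x. a x = A *v x"
    and "\<psi> \<in> borel_measurable lebesgue"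
    and "\<And>x. 0 \<le> \<psi> x"
    and "bounded (range \<psi>)"
    and "{x. \<psi> x \<noteq> 0} \<subseteq> cball 0 1"
    and "\<And>x y. K x y = \<psi> (y - a x) + \<psi> (x - a y)"
    and "1 \<le> p"
  shows "first_eigenvalue p K =
    ennreal (2 * \<bar>1 / \<bar>det A\<bar> powr (1 / p) - 1\<bar> powr p * (\<integral>x. \<psi> x \<partial>lebesgue))"
proof -
  note A = assms(1) and K = assms(7)[unfolded assms(2)] and p = \<open>1 \<le> p\<close>
  define \<Delta> where "\<Delta> = \<bar>det A\<bar>"
  have "det A \<noteq> 0"
    using A invertible_det_nz by blast
  then have \<Delta>: "0 < \<Delta>" by (simp add: \<Delta>_def)
  define D where "D = 1 / \<Delta> powr (1 / p)"
  have D: "0 < D" and D_powr: "D powr p = 1 / \<Delta>"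
    using \<Delta> p by (simp_all add: D_def powr_divide powr_powr)
  have [measurable]: "(*v) A \<in> borel_measurable borel"
    by (intro borel_measurable_continuous_onI linear_continuous_on matrix_vector_mul_bounded_linear)

  obtain \<psi>0 where \<psi>0: "\<psi>0 \<in> borel_measurable lborel" "AE x in lborel. \<psi> x = \<psi>0 x"
    using completion_ex_borel_measurable_real[OF assms(3)] by blast
  \<comment> \<open>A Borel representative of \<open>\<psi>\<close> may violate sign and support on
    a null set; the truncation restores both at every point.\<close>
  define k where "k = (\<lambda>x. indicator (cball 0 1) x * max 0 (\<psi>0 x))"
  have [measurable]: "k \<in> borel_measurable borel"
  proof -
    have [measurable]: "\<psi>0 \<in> borel_measurable borel" "cball (0 :: real ^ 'd) 1 \<in> sets borel"
      using \<psi>0(1) by auto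
    show ?thesis unfolding k_def by measurable
  qed
  have k_nonneg: "0 \<le> k x" for x by (simp add: k_def)
  have k_supp: "k x = 0" if "1 < norm x" for x
    using that by (simp add: k_def)
  have \<psi>_k: "AE x in lborel. \<psi> x = k x"
    using \<psi>0(2)
  proof eventually_elim
    case (elim x)
    moreover have "0 \<le> \<psi>0 x" using elim assms(4)[of x] by simp
    moreover have "\<psi> x = 0 \<or> x \<in> cball 0 1" using assms(6) by auto
    ultimately show ?case by (auto simp: k_def)
  qed
  define \<Psi> where "\<Psi> = (\<integral>x. \<psi> x \<partial>lebesgue)"
  have \<Psi>_nonneg: "0 \<le> \<Psi>"
    using assms(4) by (simp add: \<Psi>_def)
  have "integrable lebesgue \<psi>"
  proof -
    obtain M where M: "\<And>x. \<bar>\<psi> x\<bar> \<le> M"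
      using assms(5) by (auto simp: bounded_iff)
    have "integrable lebesgue (\<lambda>x. M * indicator (cball (0 :: real ^ 'd) 1) x)"
      by (intro integrable_mult_right integrable_real_indicator) (auto simp: emeasure_cball)
    then show ?thesis
      using assms(3)
    proof (rule Bochner_Integration.integrable_bound, intro AE_I2)
      show "norm (\<psi> x) \<le> norm (M * indicator (cball (0 :: real ^ 'd) 1) x)" for x
        using M[of x] assms(6) by (cases "\<psi> x = 0") auto
    qed
  qed
  then have "(\<integral>\<^sup>+ x. ennreal (\<psi> x) \<partial>lebesgue) = ennreal \<Psi>"
    using assms(4) by (simp add: \<Psi>_def nn_integral_eq_integral)
  moreover have "(\<integral>\<^sup>+ x. ennreal (k x) \<partial>lborel) = (\<integral>\<^sup>+ x. ennreal (\<psi> x) \<partial>lborel)"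
    by (rule nn_integral_cong_AE) (use \<psi>_k in eventually_elim, simp)
  ultimately have k_int: "(\<integral>\<^sup>+ x. ennreal (k x) \<partial>lborel) = ennreal \<Psi>"
    by (simp add: nn_integral_completion)

  define R where "R = (\<lambda>u. (\<integral>\<^sup>+ y. (\<integral>\<^sup>+ x. ennreal (K x y * \<bar>u x - u y\<bar> powr p) \<partial>lebesgue) \<partial>lebesgue)
        / (\<integral>\<^sup>+ x. ennreal (\<bar>u x\<bar> powr p) \<partial>lebesgue))"
  define X where "X = {u. Lp_function p u \<and> \<not> (AE x in (lebesgue :: (real ^ 'd) measure). u x = 0)}"
  define I where "I = first_eigenvalue p K"
  have I: "I = (INF u \<in> X. R u)"
    by (simp add: I_def first_eigenvalue_def R_def X_def)
  \<comment> \<open>The p-th power of the L^p distance between \<open>u\<close> and its affine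
    translate by \<open>z\<close>.\<close>
  define S where "S = (\<lambda>u z. \<integral>\<^sup>+ x. ennreal (\<bar>u x - u (A *v x + z)\<bar> powr p) \<partial>lborel)"
  have energy: "(\<integral>\<^sup>+ y. (\<integral>\<^sup>+ x. ennreal (K x y * \<bar>u x - u y\<bar> powr p) \<partial>lebesgue) \<partial>lebesgue)
      = 2 * (\<integral>\<^sup>+ z. ennreal (k z) * S v z \<partial>lborel)"
    if "AE x in lborel. u x = v x" "v \<in> borel_measurable borel" for u v
    using kernel_energy_cong_AE[OF A \<psi>_k that(1), of p]
      kernel_energy_borel[OF _ that(2), of k A p] k_nonneg
    by (simp add: K nn_integral_completion S_def)
  have affine_int: "(\<integral>\<^sup>+ x. ennreal (\<bar>v (A *v x + z)\<bar> powr p) \<partial>lborel)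
      = ennreal (1 / \<Delta>) * (\<integral>\<^sup>+ x. ennreal (\<bar>v x\<bar> powr p) \<partial>lborel)"
    if [measurable]: "v \<in> borel_measurable borel" for v z
    unfolding \<Delta>_def by (rule nn_integral_lborel_affine_matrix[OF A]) measurable

  have lower: "ennreal (2 * \<bar>D - 1\<bar> powr p * \<Psi>) \<le> R u" if "u \<in> X" for u
  proof -
    from that have u: "u \<in> borel_measurable lebesgue" "integrable lebesgue (\<lambda>x. \<bar>u x\<bar> powr p)"
      and u_nz: "\<not> (AE x in lebesgue. u x = 0)"
      by (auto simp: X_def Lp_function_def)
    obtain v where v: "v \<in> borel_measurable lborel" "AE x in lborel. u x = v x"
      using completion_ex_borel_measurable_real[OF u(1)] by blast
    then have [measurable]: "v \<in> borel_measurable borel" by simp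
    define U where "U = (\<integral>x. \<bar>u x\<bar> powr p \<partial>lebesgue)"
    have U: "(\<integral>\<^sup>+ x. ennreal (\<bar>u x\<bar> powr p) \<partial>lebesgue) = ennreal U"
      using u(2) by (simp add: U_def nn_integral_eq_integral)
    have "(\<integral>\<^sup>+ x. ennreal (\<bar>u x\<bar> powr p) \<partial>lebesgue) \<noteq> 0"
      using u_nz u(1) by (subst nn_integral_0_iff_AE) auto
    then have "0 < U"
      using U by (metis ennreal_eq_0_iff not_le)
    have "(\<integral>\<^sup>+ x. ennreal (\<bar>v x\<bar> powr p) \<partial>lborel) = (\<integral>\<^sup>+ x. ennreal (\<bar>u x\<bar> powr p) \<partial>lborel)"
      using v(2) by (intro nn_integral_cong_AE) (auto elim!: eventually_mono)
    then have vU: "(\<integral>\<^sup>+ x. ennreal (\<bar>v x\<bar> powr p) \<partial>lborel) = ennreal U"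
      using U by (simp add: nn_integral_completion)
    \<comment> \<open>The reverse triangle inequality with norms 1 and \<open>D\<close>, where
      \<open>D powr p = 1 / \<Delta>\<close> is the factor from the substitution. The bound is
      independent of \<open>z\<close>, so integration against \<open>k\<close> produces
      \<open>\<Psi>\<close>.\<close>
    have "ennreal (\<bar>1 - D\<bar> powr p * U) \<le> S v z" for z
      unfolding S_def
      using \<open>0 < U\<close> D p \<Delta>
      by (intro nn_integral_abs_diff_powr_ge)
        (auto simp: vU affine_int D_powr simp flip: ennreal_mult)
    then have "(\<integral>\<^sup>+ z. ennreal (k z) * ennreal (\<bar>1 - D\<bar> powr p * U) \<partial>lborel)
        \<le> (\<integral>\<^sup>+ z. ennreal (k z) * S v z \<partial>lborel)"
      by (intro nn_integral_mono mult_left_mono) auto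
    then have "ennreal (\<Psi> * (\<bar>1 - D\<bar> powr p * U)) \<le> (\<integral>\<^sup>+ z. ennreal (k z) * S v z \<partial>lborel)"
      using \<open>0 < U\<close> \<Psi>_nonneg by (simp add: nn_integral_multc k_int ennreal_mult)
    then have "2 * ennreal (\<Psi> * (\<bar>1 - D\<bar> powr p * U)) / ennreal U \<le> R u"
      unfolding R_def U energy[OF v(2) \<open>v \<in> borel_measurable borel\<close>]
      by (intro divide_right_mono_ennreal mult_left_mono) auto
    moreover have "2 * ennreal (\<Psi> * (\<bar>1 - D\<bar> powr p * U)) / ennreal U
        = ennreal (2 * \<bar>D - 1\<bar> powr p * \<Psi>)"
    proof -
      have "2 * ennreal (\<Psi> * (\<bar>1 - D\<bar> powr p * U)) = ennreal (2 * (\<Psi> * (\<bar>1 - D\<bar> powr p * U)))"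
        using \<open>0 < U\<close> \<Psi>_nonneg by (simp add: ennreal_mult)
      then show ?thesis
        using \<open>0 < U\<close> \<Psi>_nonneg by (simp add: divide_ennreal abs_minus_commute mult_ac)
    qed
    ultimately show ?thesis by simp
  qed

  \<comment> \<open>Here \<open>\<epsilon>\<close> is the invariance defect of the density and
    \<open>\<theta>\<close> the weight that separates the main term from this defect; both are sent
    to 0 afterwards.\<close>
  have upper: "I \<le> ennreal (2 * \<Psi> * ((1 - \<theta>) powr (1 - p) * \<bar>D - 1\<bar> powr p + \<theta> powr (1 - p) * (1 / \<Delta>) * \<epsilon>))"
    if \<theta>: "0 < \<theta>" "\<theta> < 1" and \<epsilon>: "0 < \<epsilon>" for \<theta> \<epsilon>
  proof -
    let ?C = "(1 - \<theta>) powr (1 - p) * \<bar>D - 1\<bar> powr p" and ?E = "\<theta> powr (1 - p) * (1 / \<Delta>)"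
    have C: "0 \<le> ?C" and E: "0 \<le> ?E" using \<Delta> by auto
    obtain f :: "real ^ 'd \<Rightarrow> real" and F where f[measurable]: "f \<in> borel_measurable borel"
      and f_nonneg: "\<And>x. 0 \<le> f x" and F: "0 < F" and f_int: "(\<integral>\<^sup>+ x. ennreal (f x) \<partial>lborel) = ennreal F"
      and f_inv: "\<And>z. norm z \<le> 1 \<Longrightarrow>
        (\<integral>\<^sup>+ x. ennreal \<bar>\<Delta> * f (A *v x + z) - f x\<bar> \<partial>lborel) \<le> ennreal (\<epsilon> * F)"
      using almost_invariant_density[OF A \<epsilon>] unfolding \<Delta>_def by blast
    define u where "u = (\<lambda>x. f x powr (1 / p))"
    have u_nonneg: "0 \<le> u x" and u_powr: "u x powr p = f x" for x
      using f_nonneg[of x] p by (simp_all add: u_def powr_powr)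
    have u_meas[measurable]: "u \<in> borel_measurable borel"
      unfolding u_def by measurable
    have u_int: "(\<integral>\<^sup>+ x. ennreal (\<bar>u x\<bar> powr p) \<partial>lebesgue) = ennreal F"
      by (simp add: nn_integral_completion u_nonneg u_powr f_int)
    have "u \<in> X"
    proof -
      have meas: "u \<in> borel_measurable lebesgue"
        using u_meas by (intro measurable_completion) simp
      moreover have "integrable lebesgue (\<lambda>x. \<bar>u x\<bar> powr p)"
        using u_int meas by (intro integrableI_nonneg) auto
      moreover have "\<not> (AE x in lebesgue. u x = 0)"
      proof
        assume "AE x in lebesgue. u x = 0"
        then have "(\<integral>\<^sup>+ x. ennreal (\<bar>u x\<bar> powr p) \<partial>lebesgue) = (\<integral>\<^sup>+ x. 0 \<partial>(lebesgue :: (real ^ 'd) measure))"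
          by (intro nn_integral_cong_AE) (auto elim!: eventually_mono)
        then show False using u_int F by simp
      qed
      ultimately show ?thesis by (simp add: X_def Lp_function_def)
    qed
    have S_le: "S u z \<le> ennreal ((?C + ?E * \<epsilon>) * F)" if z: "norm z \<le> 1" for z
    proof -
      have "\<bar>u x - u (A *v x + z)\<bar> powr p \<le> ?C * f x + ?E * \<bar>\<Delta> * f (A *v x + z) - f x\<bar>" for x
      proof -
        \<comment> \<open>The p-th root of the transported density: it is close to \<open>u\<close>,
          and the translate of \<open>u\<close> is exactly \<open>D * v\<close>.\<close>
        define v where "v = (\<Delta> * f (A *v x + z)) powr (1 / p)"
        have v: "0 \<le> v" "v powr p = \<Delta> * f (A *v x + z)" "u (A *v x + z) = D * v"
          using \<Delta> p f_nonneg[of "A *v x + z"]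
          by (simp_all add: v_def u_def D_def powr_powr powr_mult)
        have "\<bar>u x - v\<bar> powr p \<le> \<bar>u x powr p - v powr p\<bar>"
          using abs_diff_powr_le[OF u_nonneg v(1) p] .
        then have d: "\<bar>u x - v\<bar> powr p \<le> \<bar>\<Delta> * f (A *v x + z) - f x\<bar>"
          by (simp add: v u_powr abs_minus_commute)
        \<comment> \<open>The first summand carries the optimal constant; the second is controlled
          by the defect of \<open>f\<close>.\<close>
        have "u x - u (A *v x + z) = (1 - D) * u x + D * (u x - v)"
          by (simp only: v(3)) (simp add: algebra_simps)
        then have "\<bar>u x - u (A *v x + z)\<bar> powr p \<le> (1 - \<theta>) powr (1 - p) * \<bar>(1 - D) * u x\<bar> powr p
            + \<theta> powr (1 - p) * \<bar>D * (u x - v)\<bar> powr p"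
          using abs_add_powr_le_weighted[OF \<theta> p] by metis
        also have "\<dots> = ?C * f x + ?E * \<bar>u x - v\<bar> powr p"
          using D u_nonneg[of x]
          by (simp add: abs_mult powr_mult u_powr D_powr abs_minus_commute)
        also have "\<dots> \<le> ?C * f x + ?E * \<bar>\<Delta> * f (A *v x + z) - f x\<bar>"
          using d E by (intro add_left_mono mult_left_mono) auto
        finally show ?thesis .
      qed
      then have "S u z \<le> (\<integral>\<^sup>+ x. ennreal ?C * ennreal (f x) + ennreal ?E * ennreal \<bar>\<Delta> * f (A *v x + z) - f x\<bar> \<partial>lborel)"
        unfolding S_def using C E f_nonneg
        by (intro nn_integral_mono) (simp del: times_divide_eq_right flip: ennreal_mult ennreal_plus)
      also have "\<dots> = ennreal ?C * ennreal F + ennreal ?E * (\<integral>\<^sup>+ x. ennreal \<bar>\<Delta> * f (A *v x + z) - f x\<bar> \<partial>lborel)"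
        by (simp add: nn_integral_add nn_integral_cmult f_int)
      also have "\<dots> \<le> ennreal ?C * ennreal F + ennreal ?E * ennreal (\<epsilon> * F)"
        using f_inv[OF z] by (intro add_left_mono mult_left_mono) auto
      also have "\<dots> = ennreal (?C * F + ?E * (\<epsilon> * F))"
        using C E F \<epsilon> \<Delta> by (simp del: times_divide_eq_right flip: ennreal_mult ennreal_plus)
      finally show ?thesis by (simp add: algebra_simps)
    qed
    let ?B = "(?C + ?E * \<epsilon>) * F"
    have B: "0 \<le> ?B" using C E F \<epsilon> \<Delta> by (intro mult_nonneg_nonneg add_nonneg_nonneg) auto
    \<comment> \<open>Near invariance is available only for \<open>norm z \<le> 1\<close>; outside
      this ball \<open>k\<close> vanishes.\<close>
    have "ennreal (k z) * S u z \<le> ennreal (k z) * ennreal ?B" for z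
    proof (cases "norm z \<le> 1")
      case True then show ?thesis by (intro mult_left_mono S_le) auto
    next
      case False then show ?thesis by (simp add: k_supp)
    qed
    then have "(\<integral>\<^sup>+ z. ennreal (k z) * S u z \<partial>lborel) \<le> (\<integral>\<^sup>+ z. ennreal (k z) * ennreal ?B \<partial>lborel)"
      by (rule nn_integral_mono)
    also have "\<dots> = ennreal (\<Psi> * ?B)"
      using \<Psi>_nonneg B by (simp add: nn_integral_multc k_int ennreal_mult del: times_divide_eq_right)
    finally have "R u \<le> 2 * ennreal (\<Psi> * ?B) / ennreal F"
      unfolding R_def u_int energy[OF AE_I2[OF refl] u_meas]
      by (intro divide_right_mono_ennreal mult_left_mono) auto
    also have "2 * ennreal (\<Psi> * ?B) = ennreal (2 * (\<Psi> * ?B))"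
      using \<Psi>_nonneg B by (simp add: ennreal_mult del: times_divide_eq_right)
    also have "\<dots> / ennreal F = ennreal (2 * (\<Psi> * ?B) / F)"
      by (rule divide_ennreal[OF mult_nonneg_nonneg[OF _ mult_nonneg_nonneg[OF \<Psi>_nonneg B]] F]) simp
    also have "2 * (\<Psi> * ?B) / F = 2 * \<Psi> * (?C + ?E * \<epsilon>)"
      using F by simp
    finally have "R u \<le> ennreal (2 * \<Psi> * (?C + ?E * \<epsilon>))" .
    then show ?thesis
      unfolding I using \<open>u \<in> X\<close> by (rule INF_lower2[rotated])
  qed

  have "I \<le> ennreal (2 * \<bar>D - 1\<bar> powr p * \<Psi>)"
  proof -
    \<comment> \<open>The limit in \<open>\<epsilon>\<close> comes first, at fixed
      \<open>\<theta>\<close>: for \<open>p > 1\<close> its coefficient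
      \<open>\<theta> powr (1 - p)\<close> is unbounded as \<open>\<theta>\<close> tends to
      0.\<close>
    have step: "I \<le> ennreal (2 * \<Psi> * ((1 - \<theta>) powr (1 - p) * \<bar>D - 1\<bar> powr p))" if "0 < \<theta>" "\<theta> < 1" for \<theta>
    proof (rule tendsto_lowerbound)
      show "((\<lambda>\<epsilon>. ennreal (2 * \<Psi> * ((1 - \<theta>) powr (1 - p) * \<bar>D - 1\<bar> powr p + \<theta> powr (1 - p) * (1 / \<Delta>) * \<epsilon>)))
          \<longlongrightarrow> ennreal (2 * \<Psi> * ((1 - \<theta>) powr (1 - p) * \<bar>D - 1\<bar> powr p))) (at_right 0)"
        using \<Delta> by (auto intro!: tendsto_eq_intros tendsto_ennrealI)
      show "\<forall>\<^sub>F \<epsilon> in at_right 0. I \<le> ennreal (2 * \<Psi> * ((1 - \<theta>) powr (1 - p) * \<bar>D - 1\<bar> powr p + \<theta> powr (1 - p) * (1 / \<Delta>) * \<epsilon>))"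
        using upper[OF that] eventually_at_right_less[of "0::real"] by (auto elim!: eventually_mono)
    qed simp
    have "I \<le> ennreal (2 * \<Psi> * \<bar>D - 1\<bar> powr p)"
    proof (rule tendsto_lowerbound)
      show "((\<lambda>\<theta>. ennreal (2 * \<Psi> * ((1 - \<theta>) powr (1 - p) * \<bar>D - 1\<bar> powr p)))
          \<longlongrightarrow> ennreal (2 * \<Psi> * \<bar>D - 1\<bar> powr p)) (at_right 0)"
        by (auto intro!: tendsto_eq_intros tendsto_ennrealI)
      show "\<forall>\<^sub>F \<theta> in at_right 0. I \<le> ennreal (2 * \<Psi> * ((1 - \<theta>) powr (1 - p) * \<bar>D - 1\<bar> powr p))"
        using step eventually_at_right_real[of 0 "1::real"] by (auto elim!: eventually_mono)
    qed simp
    then show ?thesis by (simp add: mult_ac)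
  qed
  moreover have "ennreal (2 * \<bar>D - 1\<bar> powr p * \<Psi>) \<le> I"
    unfolding I by (intro INF_greatest lower)
  ultimately show ?thesis
    by (simp add: I_def D_def \<Delta>_def \<Psi>_def)
qed

end
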